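(* For every integer $n \ge 1$ there exists a maximal distinct pair-sum (dps) polytope in $\mathbb{R}^n$, i.e. a dps polytope $\mathcal{P} \subset \mathbb{R}^n$ with $N(\mathcal{P}) = |\mathcal{P}\cap\mathbb{Z}^n| = 2^n$.
   Context: A lattice polytope $\mathcal{P}$ in $\mathbb{R}^n$ is the convex hull of a finite subset of $\mathbb{Z}^n$. Write $\mathcal{L}(\mathcal{P}) := \mathcal{P} \cap \mathbb{Z}^n = \{v_1,\dots,v_N\}$, where $N = N(\mathcal{P}) := |\mathcal{L}(\mathcal{P})|$. The lattice polytope $\mathcal{P}$ is called a distinct pair-sum (dps) polytope if the $N + \binom{N}{2}$ sums $2v_1,\dots,2v_N$ and $v_i+v_j$ ($1 \le i<j\le N$) are all distinct, i.e. $v_i + v_j = v_k + v_\ell$ implies $\{i,j\}=\{k,\ell\}$ as multisets. A dps polytope $\mathcal{P}\subset\mathbb{R}^n$ is called maximal if $N(\mathcal{P}) = 2^n$. *)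

theory Defs
  imports "HOL-Analysis.Analysis" "HOL-Library.Multiset"
begin

definition integer_lattice :: "(real ^ 'n::finite) set" where
  "integer_lattice = {v. \<forall>i. v $ i \<in> \<int>}"

definition lattice_polytope :: "(real ^ 'n::finite) set \<Rightarrow> bool" where
  "lattice_polytope P \<longleftrightarrow> (\<exists>V. finite V \<and> V \<subseteq> integer_lattice \<and> P = convex hull V)"

definition lattice_points :: "(real ^ 'n::finite) set \<Rightarrow> (real ^ 'n) set" where
  "lattice_points P = P \<inter> integer_lattice"

text \<open>All pair sums, including the doubles \<open>2v\<close>, are distinct:
  a sum of two lattice points determines the multiset of its summands.\<close>

definition dps_polytope :: "(real ^ 'n::finite) set \<Rightarrow> bool" where
  "dps_polytope P \<longleftrightarrow> lattice_polytope P \<and>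
     (\<forall>a \<in> lattice_points P. \<forall>b \<in> lattice_points P.
      \<forall>c \<in> lattice_points P. \<forall>d \<in> lattice_points P.
        a + b = c + d \<longrightarrow> {#a, b#} = {#c, d#})"

definition maximal_dps_polytope :: "(real ^ 'n::finite) set \<Rightarrow> bool" where
  "maximal_dps_polytope P \<longleftrightarrow> dps_polytope P \<and> card (lattice_points P) = 2 ^ CARD('n)"

end

theory Submission
  imports Defs
begin

text \<open>Induction on the dimension. Given a dps polytope with lattice points \<open>S\<close> in the
  hyperplane \<open>x\<^sub>j = 0\<close>, put \<open>S\<close> at height \<open>0\<close> and a unimodular image \<open>A S\<close> at height \<open>1\<close>;
  the hull of the union has no further lattice points. It is dps as soon as no nonzero difference
  of \<open>S\<close> equals a difference of \<open>A S\<close>, which a shear \<open>A x = x + t (w \<bullet> x) u\<close> achieves when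
  \<open>w \<bullet> u = 0\<close>, \<open>w\<close> is orthogonal to no nonzero difference, and \<open>t\<close> is generic. Such a \<open>u\<close> needs two
  dimensions, so the segment and the triangle with one interior point are the base cases.\<close>

section \<open>Finite point sets in place of polytopes\<close>

definition distinct_pair_sums :: "'a::ab_semigroup_add set \<Rightarrow> bool" where
  "distinct_pair_sums S \<longleftrightarrow>
     (\<forall>a\<in>S. \<forall>b\<in>S. \<forall>c\<in>S. \<forall>d\<in>S. a + b = c + d \<longrightarrow> a = c \<and> b = d \<or> a = d \<and> b = c)"

text \<open>The dimension is a type and cannot vary in an induction, so the ambient space is fixed
  and the set \<open>I\<close> of coordinates grows instead: \<open>S\<close> lives in the
  coordinate subspace of \<open>I\<close>. The hull equation says both that \<open>S\<close> is
  integral and that its hull adds no lattice points.\<close>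

definition max_dps_points :: "'n set \<Rightarrow> (real ^ 'n::finite) set \<Rightarrow> bool" where
  "max_dps_points I S \<longleftrightarrow> finite S \<and> card S = 2 ^ card I \<and> (\<forall>x\<in>S. \<forall>i. i \<notin> I \<longrightarrow> x $ i = 0) \<and>
     convex hull S \<inter> integer_lattice = S \<and> distinct_pair_sums S"

lemma maximal_dps_polytope_convex_hull:
  fixes S :: "(real ^ 'n::finite) set"
  assumes "max_dps_points UNIV S"
  shows "maximal_dps_polytope (convex hull S)"
proof -
  have S: "finite S" "card S = 2 ^ CARD('n)" "convex hull S \<inter> integer_lattice = S"
    "distinct_pair_sums S"
    using assms by (auto simp: max_dps_points_def)
  have mset: "{#a, b#} = {#c, d#}" if "a \<in> S" "b \<in> S" "c \<in> S" "d \<in> S" "a + b = c + d" for a b c d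
  proof -
    have "a = c \<and> b = d \<or> a = d \<and> b = c"
      using S(4) that unfolding distinct_pair_sums_def by blast
    then show ?thesis by (auto simp: add_mset_commute)
  qed
  have lattice: "lattice_polytope (convex hull S)"
    using S unfolding lattice_polytope_def by blast
  have "lattice_points (convex hull S) = S"
    using S(3) by (simp only: lattice_points_def)
  then show ?thesis
    unfolding maximal_dps_polytope_def dps_polytope_def
    by (simp only:) (intro conjI ballI impI lattice S(2) mset)
qed

section \<open>The integer lattice and coordinate subspaces\<close>

lemma integer_lattice_add [intro!]:
  "x \<in> integer_lattice \<Longrightarrow> y \<in> integer_lattice \<Longrightarrow> x + y \<in> integer_lattice"
  by (auto simp: integer_lattice_def)

lemma integer_lattice_diff [intro!]:
  "x \<in> integer_lattice \<Longrightarrow> y \<in> integer_lattice \<Longrightarrow> x - y \<in> integer_lattice"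
  by (auto simp: integer_lattice_def)

lemma integer_lattice_scaleR [intro!]:
  "c \<in> \<int> \<Longrightarrow> x \<in> integer_lattice \<Longrightarrow> c *\<^sub>R x \<in> integer_lattice"
  by (auto simp: integer_lattice_def)

lemma integer_lattice_axis [intro!]: "c \<in> \<int> \<Longrightarrow> axis i c \<in> integer_lattice"
  by (auto simp: integer_lattice_def axis_def)

lemma inner_integer_lattice [intro]:
  "x \<in> integer_lattice \<Longrightarrow> y \<in> integer_lattice \<Longrightarrow> x \<bullet> y \<in> \<int>"
  by (auto simp: integer_lattice_def inner_vec_def intro!: Ints_sum Ints_mult)

lemma convex_supported: "convex {x :: real ^ 'n::finite. \<forall>i. i \<notin> I \<longrightarrow> x $ i = 0}"
  by (auto simp: convex_def)

lemma eq_iff_coords_supported: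
  fixes x y :: "real ^ 'n::finite"
  assumes "\<forall>i. i \<notin> I \<longrightarrow> x $ i = 0" "\<forall>i. i \<notin> I \<longrightarrow> y $ i = 0"
  shows "x = y \<longleftrightarrow> (\<forall>i\<in>I. x $ i = y $ i)"
  using assms by (metis vec_eq_iff)

section \<open>Base cases in dimensions one and two\<close>

lemma max_dps_points_segment:
  fixes a :: "'n::finite"
  shows "max_dps_points {a} {0, axis a 1}"
proof -
  let ?S = "{0, axis a 1} :: (real ^ 'n) set"
  have ne: "axis a (1::real) \<noteq> 0" by simp
  \<comment> \<open>An outer description suffices: \<open>?H\<close> is convex and contains
    \<open>?S\<close>, and its lattice points are found from the coordinate \<open>a\<close>
    alone.\<close>
  let ?H = "{x :: real ^ 'n. \<forall>i. i \<notin> {a} \<longrightarrow> x $ i = 0} \<inter>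
    {x. axis a 1 \<bullet> x \<ge> 0} \<inter> {x. axis a 1 \<bullet> x \<le> 1}"
  have "?S \<subseteq> ?H" by (auto simp: inner_axis') (auto simp: axis_def)
  then have "convex hull ?S \<subseteq> ?H"
    by (intro hull_minimal convex_Int convex_supported convex_halfspace_le convex_halfspace_ge) auto
  moreover have "x \<in> ?S" if x: "x \<in> ?H" "x \<in> integer_lattice" for x
  proof -
    obtain k :: int where k: "x $ a = of_int k"
      using x(2) by (auto simp: integer_lattice_def elim: Ints_cases)
    have "k = 0 \<or> k = 1" using x(1) k by (auto simp: inner_axis')
    then have "x $ a = 0 \<or> x $ a = 1" using k by auto
    then show ?thesis using x(1) by (auto simp: vec_eq_iff axis_def)
  qed
  ultimately have "convex hull ?S \<inter> integer_lattice \<subseteq> ?S" by blast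
  moreover have "?S \<subseteq> integer_lattice" by (auto simp: integer_lattice_def axis_def)
  ultimately have "convex hull ?S \<inter> integer_lattice = ?S"
    by (intro subset_antisym Int_greatest hull_subset)
  moreover have "distinct_pair_sums ?S"
    unfolding distinct_pair_sums_def
  proof (intro ballI impI)
    fix c d e f assume *: "c \<in> ?S" "d \<in> ?S" "e \<in> ?S" "f \<in> ?S" "c + d = e + f"
    have "c $ a + d $ a = e $ a + f $ a" using *(5) by (metis vector_add_component)
    then show "c = e \<and> d = f \<or> c = f \<and> d = e"
      using *(1-4) by (elim insertE emptyE; hypsubst) simp_all
  qed
  ultimately show ?thesis using ne by (auto simp: max_dps_points_def axis_def)
qed

text \<open>The origin is the centroid of the other three points. Three linear inequalities enclose
  the triangle, and their only integer solutions are the four given points; the pair sums are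
  compared on the coordinates \<open>a\<close> and \<open>b\<close>.\<close>

lemma max_dps_points_triangle:
  fixes a b :: "'n::finite"
  assumes "a \<noteq> b"
  shows "max_dps_points {a, b} {0, axis a 1, axis b 1, - axis a 1 - axis b 1}"
proof -
  let ?S = "{0, axis a 1, axis b 1, - axis a 1 - axis b 1} :: (real ^ 'n) set"
  let ?Z = "{x :: real ^ 'n. \<forall>i. i \<notin> {a, b} \<longrightarrow> x $ i = 0}"
  \<comment> \<open>One half-plane for each edge of the triangle; \<open>axis b 2\<close> is twice
    the unit vector.\<close>
  let ?H = "?Z \<inter> {x. (axis a 1 + axis b 1) \<bullet> x \<le> 1} \<inter>
    {x. (axis a 1 - axis b 2) \<bullet> x \<le> 1} \<inter> {x. (axis b 1 - axis a 2) \<bullet> x \<le> 1}"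
  have sup: "?S \<subseteq> ?Z" by (auto simp: axis_def)
  have eqI: "x = y" if "x \<in> ?Z" "y \<in> ?Z" "x $ a = y $ a" "x $ b = y $ b" for x y
    using that eq_iff_coords_supported[of "{a, b}" x y] by simp
  note coords = inner_add_left inner_diff_left inner_axis'
  have ax: "axis a (1::real) $ a = 1" "axis a (1::real) $ b = 0"
    "axis b (1::real) $ a = 0" "axis b (1::real) $ b = 1"
    using assms by (auto simp: axis_def)
  have "?S \<subseteq> ?H" using sup by (auto simp: coords ax)
  then have "convex hull ?S \<subseteq> ?H"
    by (intro hull_minimal convex_Int convex_supported convex_halfspace_le) auto
  moreover have "x \<in> ?S" if x: "x \<in> ?H" "x \<in> integer_lattice" for x
  proof -
    obtain p q :: int where pq: "x $ a = of_int p" "x $ b = of_int q"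
      using x(2) unfolding integer_lattice_def by (metis (mono_tags) Ints_cases mem_Collect_eq)
    have "real_of_int (p + q) \<le> of_int 1" "real_of_int (p - 2 * q) \<le> of_int 1"
      "real_of_int (q - 2 * p) \<le> of_int 1"
      using x(1) pq by (auto simp: coords)
    then have "p + q \<le> 1" "p - 2 * q \<le> 1" "q - 2 * p \<le> 1" by (simp_all only: of_int_le_iff)
    then have "p = 0 \<and> q = 0 \<or> p = 1 \<and> q = 0 \<or> p = 0 \<and> q = 1 \<or> p = -1 \<and> q = -1"
      by presburger
    then have "\<exists>y\<in>?S. x $ a = y $ a \<and> x $ b = y $ b" using pq by (auto simp: ax)
    then show ?thesis using eqI x(1) sup by blast
  qed
  ultimately have "convex hull ?S \<inter> integer_lattice \<subseteq> ?S" by blast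
  moreover have "?S \<subseteq> integer_lattice" by (auto simp: integer_lattice_def axis_def)
  ultimately have hull: "convex hull ?S \<inter> integer_lattice = ?S"
    by (intro subset_antisym Int_greatest hull_subset)
  have "distinct_pair_sums ?S"
    unfolding distinct_pair_sums_def
  proof (intro ballI impI)
    fix c d e f assume *: "c \<in> ?S" "d \<in> ?S" "e \<in> ?S" "f \<in> ?S" "c + d = e + f"
    have "c $ a + d $ a = e $ a + f $ a" "c $ b + d $ b = e $ b + f $ b"
      using *(5) by (metis vector_add_component)+
    then show "c = e \<and> d = f \<or> c = f \<and> d = e"
      using *(1-4) by (elim insertE emptyE; hypsubst) (simp_all add: ax)
  qed
  moreover have "card ?S = 4"
  proof -
    \<comment> \<open>The coordinates \<open>a\<close> and \<open>b\<close> already separate the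
      four points.\<close>
    have "distinct (map (\<lambda>x. (x $ a, x $ b)) [0, axis a 1, axis b 1, - axis a 1 - axis b (1::real)])"
      by (simp add: ax)
    then have "distinct [0, axis a 1, axis b 1, - axis a 1 - axis b (1::real)]"
      unfolding distinct_map by blast
    then show ?thesis using distinct_card by fastforce
  qed
  ultimately show ?thesis using sup hull assms unfolding max_dps_points_def by auto
qed

section \<open>Generic integer choices and the shear\<close>

lemma finite_bad_multiples:
  fixes x y z :: "'a::real_vector"
  assumes "y \<noteq> 0"
  shows "finite {k :: int. x + of_int k *\<^sub>R y = z}"
proof (rule finite_subset)
  \<comment> \<open>As \<open>y\<close> is nonzero, at most one \<open>k\<close> solves the
    equation. \<open>SOME\<close> picks it if it exists; otherwise the left side is empty.\<close>
  show "{k :: int. x + of_int k *\<^sub>R y = z} \<subseteq> {SOME k. x + of_int k *\<^sub>R y = z}"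
  proof
    fix k :: int assume "k \<in> {k. x + of_int k *\<^sub>R y = z}"
    then have k: "x + of_int k *\<^sub>R y = z" by simp
    then have "x + of_int (SOME k. x + of_int k *\<^sub>R y = z) *\<^sub>R y = z"
      by (rule someI)
    then have "of_int k *\<^sub>R y = of_int (SOME k. x + of_int k *\<^sub>R y = z) *\<^sub>R y"
      using k by (metis add_left_cancel)
    then show "k \<in> {SOME k. x + of_int k *\<^sub>R y = z}" using assms by simp
  qed
qed simp

text \<open>If \<open>w\<close> serves \<open>F\<close> but is orthogonal to the new vector
  \<open>f\<close>, replace it by \<open>f + k w\<close>: its product with \<open>f\<close> is
  \<open>f \<bullet> f\<close>, which is nonzero, and each \<open>g\<close> in \<open>F\<close>
  rules out at most one integer \<open>k\<close>.\<close>

lemma exists_lattice_vector_not_orthogonal: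
  fixes F :: "(real ^ 'n::finite) set"
  assumes "finite F" "F \<subseteq> integer_lattice" "0 \<notin> F"
  shows "\<exists>w\<in>integer_lattice. \<forall>f\<in>F. w \<bullet> f \<noteq> 0"
  using assms
proof (induction F rule: finite_induct)
  case empty
  then show ?case by (auto simp: integer_lattice_def intro!: exI[of _ 0])
next
  case (insert f F)
  then obtain w where w: "w \<in> integer_lattice" "\<forall>g\<in>F. w \<bullet> g \<noteq> 0" by auto
  show ?case
  proof (cases "w \<bullet> f = 0")
    case False
    then show ?thesis using w by auto
  next
    case True
    have "finite (\<Union>g\<in>F. {k :: int. f \<bullet> g + of_int k *\<^sub>R (w \<bullet> g) = 0})"
      using insert.hyps(1) w(2) by (intro finite_UN_I finite_bad_multiples) auto
    then obtain k :: int where "k \<notin> (\<Union>g\<in>F. {k :: int. f \<bullet> g + of_int k *\<^sub>R (w \<bullet> g) = 0})"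
      using ex_new_if_finite infinite_UNIV_int by blast
    then have "\<forall>g\<in>F. (f + of_int k *\<^sub>R w) \<bullet> g \<noteq> 0" by (auto simp: inner_add_left)
    moreover have "(f + of_int k *\<^sub>R w) \<bullet> f \<noteq> 0" using True insert.prems by (auto simp: inner_add_left)
    moreover have "f + of_int k *\<^sub>R w \<in> integer_lattice" using w insert.prems by auto
    ultimately show ?thesis by blast
  qed
qed

text \<open>Because \<open>w \<bullet> u = 0\<close>, the shear with \<open>-t\<close> undoes the
  shear with \<open>t\<close>, so both \<open>A\<close> and its inverse \<open>B\<close> are
  integral. The last property keeps supports within any coordinate set containing \<open>a\<close>
  and \<open>b\<close>.\<close>

lemma exists_unimodular_displacing:
  fixes F :: "(real ^ 'n::finite) set" and a b :: 'n
  assumes "finite F" "F \<subseteq> integer_lattice" "0 \<notin> F" "a \<noteq> b"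
  obtains A B where "linear A" "\<And>x. B (A x) = x" "A ` F \<inter> F = {}"
    "\<And>x. x \<in> integer_lattice \<Longrightarrow> A x \<in> integer_lattice"
    "\<And>x. x \<in> integer_lattice \<Longrightarrow> B x \<in> integer_lattice"
    "\<And>x i. i \<noteq> a \<Longrightarrow> i \<noteq> b \<Longrightarrow> A x $ i = x $ i"
proof -
  \<comment> \<open>Adding \<open>axis a 1\<close> to \<open>F\<close> forces \<open>w $ a\<close>
    to be nonzero, which makes the vector \<open>u\<close> below nonzero.\<close>
  obtain w where w: "w \<in> integer_lattice" "\<forall>f\<in>insert (axis a 1) F. w \<bullet> f \<noteq> 0"
    using exists_lattice_vector_not_orthogonal[of "insert (axis a 1) F"] assms
      integer_lattice_axis[OF Ints_1, of a] by auto
  define u where "u = w $ b *\<^sub>R axis a 1 - w $ a *\<^sub>R (axis b 1 :: real ^ 'n)"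
  have wu: "w \<bullet> u = 0" by (simp add: u_def inner_diff_right inner_axis)
  have "u $ b = - w $ a" using assms(4) by (simp add: u_def axis_def)
  moreover have "w $ a \<noteq> 0" using w(2) by (simp add: inner_axis)
  ultimately have "u \<noteq> 0" by auto
  have u: "u \<in> integer_lattice"
    using w(1) unfolding u_def by (intro integer_lattice_diff integer_lattice_scaleR integer_lattice_axis)
      (auto simp: integer_lattice_def)
  \<comment> \<open>Each pair \<open>f\<close>, \<open>g\<close> excludes at most one
    \<open>t\<close>, since \<open>(w \<bullet> f) *\<^sub>R u\<close> is nonzero.\<close>
  have "finite (\<Union>f\<in>F. \<Union>g\<in>F. {k :: int. f + of_int k *\<^sub>R ((w \<bullet> f) *\<^sub>R u) = g})"
    using assms(1) w(2) \<open>u \<noteq> 0\<close> by (intro finite_UN_I finite_bad_multiples) auto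
  then obtain t :: int where
    t: "t \<notin> (\<Union>f\<in>F. \<Union>g\<in>F. {k :: int. f + of_int k *\<^sub>R ((w \<bullet> f) *\<^sub>R u) = g})"
    using ex_new_if_finite infinite_UNIV_int by blast
  define A where "A = (\<lambda>x. x + of_int t *\<^sub>R ((w \<bullet> x) *\<^sub>R u))"
  define B where "B = (\<lambda>x. x - of_int t *\<^sub>R ((w \<bullet> x) *\<^sub>R u))"
  show ?thesis
  proof
    show "linear A" unfolding A_def
      by (rule linearI) (simp_all add: inner_add_right algebra_simps)
    show "B (A x) = x" for x by (simp add: A_def B_def inner_add_right wu)
    show "A ` F \<inter> F = {}" using t by (auto simp: A_def)
    show "A x \<in> integer_lattice" if "x \<in> integer_lattice" for x
      using that u w(1) unfolding A_def by (auto intro: Ints_mult)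
    show "B x \<in> integer_lattice" if "x \<in> integer_lattice" for x
      using that u w(1) unfolding B_def by (auto intro: Ints_mult)
    show "A x $ i = x $ i" if "i \<noteq> a" "i \<noteq> b" for x i
      using that by (simp add: A_def u_def axis_def)
  qed
qed

section \<open>Raising the dimension\<close>

text \<open>The coordinate \<open>j\<close> is the height. It confines lattice points of the new
  hull to the two levels, and the total height of a pair tells which levels its summands come from;
  only pairs with one point on each level require the displacement by \<open>A\<close>.\<close>

lemma max_dps_points_step:
  fixes I :: "'n::finite set"
  assumes S: "max_dps_points I S" and ab: "a \<in> I" "b \<in> I" "a \<noteq> b" and j: "j \<notin> I"
  shows "\<exists>S'. max_dps_points (insert j I) S'"
proof -
  have finS: "finite S" and cardS: "card S = 2 ^ card I"
    and supS: "\<And>x i. x \<in> S \<Longrightarrow> i \<notin> I \<Longrightarrow> x $ i = 0"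
    and hullS: "convex hull S \<inter> integer_lattice = S" and dpsS: "distinct_pair_sums S"
    using S by (auto simp: max_dps_points_def)
  have latS: "S \<subseteq> integer_lattice" using hullS by blast
  \<comment> \<open>A mixed coincidence \<open>x + (axis j 1 + A y') = z + (axis j 1 + A v')\<close>
    reads \<open>A (v' - y') = x - z\<close>, so \<open>A\<close> only has to move \<open>F\<close>
    off itself.\<close>
  define F where "F = (\<lambda>(x, y). x - y) ` (S \<times> S) - {0}"
  have "finite F" "F \<subseteq> integer_lattice" "0 \<notin> F"
    using finS latS unfolding F_def by auto
  then obtain A B where A: "linear A" "\<And>x. B (A x) = x" "A ` F \<inter> F = {}"
    "\<And>x. x \<in> integer_lattice \<Longrightarrow> A x \<in> integer_lattice"
    "\<And>x. x \<in> integer_lattice \<Longrightarrow> B x \<in> integer_lattice"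
    "\<And>x i. i \<noteq> a \<Longrightarrow> i \<noteq> b \<Longrightarrow> A x $ i = x $ i"
    using exists_unimodular_displacing[OF _ _ _ ab(3)] by metis
  have Aout: "A x $ i = x $ i" if "i \<notin> I" for x i
    using that ab A(6)[of i x] by metis
  define T where "T = (\<lambda>x. axis j 1 + A x) ` S"
  have injA: "inj A" using A(2) by (metis injI)
  then have "card T = card S"
    unfolding T_def by (intro card_image) (auto simp: inj_on_def)
  have Sj: "x $ j = 0" if "x \<in> S" for x using supS[OF that j] .
  have Tj: "x $ j = 1" if "x \<in> T" for x
    using that j Sj by (auto simp: T_def Aout axis_def)
  have disj: "S \<inter> T = {}" using Sj Tj by fastforce
  have latT: "T \<subseteq> integer_lattice" using latS A(4) by (auto simp: T_def)
  have hullT: "x \<in> T" if x: "x \<in> convex hull T" "x \<in> integer_lattice" for x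
  proof -
    have "convex hull T = (\<lambda>x. axis j 1 + x) ` A ` (convex hull S)"
      unfolding T_def convex_hull_linear_image[OF A(1)] convex_hull_translation[symmetric]
      by (simp add: image_image)
    then obtain y where y: "y \<in> convex hull S" "x = axis j 1 + A y" using x(1) by auto
    \<comment> \<open>Integrality of \<open>B\<close> pulls a lattice point of the upper hull back
      to a lattice point of \<open>convex hull S\<close>.\<close>
    have "y = B (x - axis j 1)" using A(2) y(2) by simp
    moreover have "x - axis j 1 \<in> integer_lattice" using x(2) by auto
    ultimately have "y \<in> integer_lattice" using A(5) by simp
    then show ?thesis using y hullS by (auto simp: T_def)
  qed
  have "x \<in> S \<union> T" if x: "x \<in> convex hull (S \<union> T)" "x \<in> integer_lattice" for x
  proof -
    have ne: "S \<noteq> {}" "T \<noteq> {}" using cardS \<open>card T = card S\<close> by auto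
    have *: "convex {x :: real ^ 'n. x $ j = c}" for c
      using convex_hyperplane[of "axis j (1::real)" c] by (simp add: inner_axis')
    have cS: "convex hull S \<subseteq> {x. x $ j = 0}"
      by (intro hull_minimal *) (auto simp: Sj)
    have cT: "convex hull T \<subseteq> {x. x $ j = 1}"
      by (intro hull_minimal *) (auto simp: Tj)
    have "convex hull (S \<union> T) = convex hull (convex hull S \<union> convex hull T)"
      by (metis hull_Un_left hull_Un_right)
    also have "\<dots> = {u *\<^sub>R s + v *\<^sub>R t |u v s t.
        u \<ge> 0 \<and> v \<ge> 0 \<and> u + v = 1 \<and> s \<in> convex hull S \<and> t \<in> convex hull T}"
      using ne by (intro convex_hull_union_two) auto
    finally obtain v u s t where u: "x = v *\<^sub>R s + u *\<^sub>R t" "v \<ge> 0" "u \<ge> 0" "v + u = 1"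
      "s \<in> convex hull S" "t \<in> convex hull T"
      using x(1) by blast
    have "s $ j = 0" "t $ j = 1" using u cS cT by blast+
    \<comment> \<open>The weight of the upper point is the height of \<open>x\<close>. Being an
      integer between 0 and 1, it places \<open>x\<close> in one of the two hulls, whose lattice
      points are known.\<close>
    then have "x $ j = u" using u(1) by simp
    then have "u \<in> \<int>" using x(2) by (auto simp: integer_lattice_def)
    then have "u = 0 \<or> u = 1" using u(2-4) by (auto elim!: Ints_cases)
    then show ?thesis using u x(2) hullS hullT by auto
  qed
  then have hull: "convex hull (S \<union> T) \<inter> integer_lattice = S \<union> T"
    using hull_subset[of "S \<union> T" convex] latS latT by blast
  have dpsT: "distinct_pair_sums T"
  proof -
    have "A x = A z \<and> A y = A v \<or> A x = A v \<and> A y = A z"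
      if "x \<in> S" "y \<in> S" "z \<in> S" "v \<in> S" "A x + A y = A z + A v" for x y z v
    proof -
      have "A (x + y) = A (z + v)" using that(5) A(1) by (simp add: linear_add)
      then have "x + y = z + v" using injA by (simp add: inj_eq)
      then show ?thesis using dpsS that(1-4) unfolding distinct_pair_sums_def by blast
    qed
    then show ?thesis by (auto simp: distinct_pair_sums_def T_def algebra_simps)
  qed
  have mixed: "x = z \<and> y = v"
    if xy: "x \<in> S" "y \<in> T" "z \<in> S" "v \<in> T" "x + y = z + v" for x y z v
  proof -
    obtain y' v' where y': "y' \<in> S" "y = axis j 1 + A y'" and v': "v' \<in> S" "v = axis j 1 + A v'"
      using xy by (auto simp: T_def)
    have eq: "A (v' - y') = x - z"
      using xy(5) y' v' A(1) by (simp add: linear_diff algebra_simps)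
    have "x = z"
    proof (rule ccontr)
      assume "x \<noteq> z"
      then have "x - z \<in> F" using xy by (auto simp: F_def)
      moreover have "v' - y' \<noteq> 0" using eq \<open>x \<noteq> z\<close> linear_0[OF A(1)] by auto
      then have "v' - y' \<in> F" using y' v' by (auto simp: F_def)
      ultimately show False using A(3) eq by (metis IntI empty_iff image_eqI)
    qed
    then show ?thesis using xy by simp
  qed
  have "x = z \<and> y = v \<or> x = v \<and> y = z"
    if xy: "x \<in> S \<union> T" "y \<in> S \<union> T" "z \<in> S \<union> T" "v \<in> S \<union> T" "x + y = z + v" for x y z v
  proof -
    have lev: "x $ j + y $ j = z $ j + v $ j" using xy(5) by (metis vector_add_component)
    \<comment> \<open>Total height 0, 2 or 1 gives the three alternatives; the four instances of
      \<open>mixed\<close> below cover the orders of the summands in the last one.\<close>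
    have "x \<in> S \<and> y \<in> S \<and> z \<in> S \<and> v \<in> S \<or> x \<in> T \<and> y \<in> T \<and> z \<in> T \<and> v \<in> T \<or>
      (x \<in> S \<and> y \<in> T \<or> x \<in> T \<and> y \<in> S) \<and> (z \<in> S \<and> v \<in> T \<or> z \<in> T \<and> v \<in> S)"
      using xy(1-4) lev by (elim UnE) (auto simp: Sj Tj)
    then show ?thesis
      using dpsS dpsT mixed[of x y z v] mixed[of y x z v] mixed[of x y v z] mixed[of y x v z] xy(5)
      unfolding distinct_pair_sums_def by (metis add.commute)
  qed
  then have "distinct_pair_sums (S \<union> T)" unfolding distinct_pair_sums_def by blast
  moreover have "card (S \<union> T) = 2 ^ card (insert j I)"
    using finS disj j cardS \<open>card T = card S\<close> by (simp add: card_Un_disjoint T_def)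
  moreover have "x $ i = 0" if "x \<in> S \<union> T" "i \<notin> insert j I" for x i
    using that supS Aout by (auto simp: T_def axis_def)
  ultimately have "max_dps_points (insert j I) (S \<union> T)"
    using hull finS by (auto simp: max_dps_points_def T_def)
  then show ?thesis by blast
qed

text \<open>The step needs two coordinates already in \<open>I\<close>, so the passage from one
  coordinate to two uses the triangle instead of extending the segment.\<close>

lemma exists_max_dps_points:
  fixes I :: "'n::finite set"
  assumes "I \<noteq> {}"
  shows "\<exists>S. max_dps_points I S"
  using finite[of I] assms
proof (induction I rule: finite_ne_induct)
  case (singleton a)
  then show ?case using max_dps_points_segment by blast
next
  case (insert j I)
  then obtain a where a: "a \<in> I" by blast
  show ?case
  proof (cases "I = {a}")
    case True
    then show ?thesis using max_dps_points_triangle[of j a] insert.hyps by blast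
  next
    case False
    then obtain b where "b \<in> I" "a \<noteq> b" using a by blast
    then show ?thesis using max_dps_points_step a insert by blast
  qed
qed

theorem theorem3: "\<exists>P :: (real ^ 'n::finite) set. maximal_dps_polytope P"
  using exists_max_dps_points[of "UNIV :: 'n set"] maximal_dps_polytope_convex_hull by blast

end
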